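(* If $n,m\geq 2$ are relatively prime integers, then $T_n\circ T_m^{-1}(x)=T_m^{-1}\circ T_n(x)$ for every $x\in I$.
   Context: $I=[0,1]$. For an integer $n\ge 2$, the symmetric $n$-tent map $T_n\colon I\to I$ is the continuous map with $T_n(i/n)=0$ for even $i\in\{0,\ldots,n\}$, $T_n(i/n)=1$ for odd $i\in\{0,\ldots,n\}$, and linear on each interval $[\frac in,\frac{i+1}n]$, $i\in\{0,\ldots,n-1\}$. For maps $f,g\colon I\to I$ and $x\in I$, $f\circ g^{-1}(x)=\{f(y): y\in I,\ g(y)=x\}$ and $g^{-1}\circ f(x)=\{z\in I: g(z)=f(x)\}$. *)

theory Defs
  imports "HOL-Analysis.Analysis"
begin

abbreviation unit_I :: "real set" where
  "unit_I \<equiv> {0..1}"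

text \<open>Maps \<open>I \<rightarrow> I\<close> are functions on all reals of which only the restriction to \<open>I\<close> matters;
  accordingly the symmetric tent map is described by the predicate below, which determines it
  on \<open>I\<close> (see the existence and uniqueness lemmas). ``Linear'' on an interval means affine.\<close>

definition is_tent_map :: "nat \<Rightarrow> (real \<Rightarrow> real) \<Rightarrow> bool" where
  "is_tent_map n T \<longleftrightarrow>
     T \<in> unit_I \<rightarrow> unit_I \<and>
     continuous_on unit_I T \<and>
     (\<forall>i\<in>{0..n}. even i \<longrightarrow> T (real i / real n) = 0) \<and>
     (\<forall>i\<in>{0..n}. odd i \<longrightarrow> T (real i / real n) = 1) \<and>
     (\<forall>i\<in>{0..<n}. \<exists>a b. \<forall>x\<in>{real i / real n..real (i + 1) / real n}. T x = a * x + b)"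

definition comp_inv :: "(real \<Rightarrow> real) \<Rightarrow> (real \<Rightarrow> real) \<Rightarrow> real \<Rightarrow> real set" where
  "comp_inv f g x = {f y | y. y \<in> unit_I \<and> g y = x}"

definition inv_comp :: "(real \<Rightarrow> real) \<Rightarrow> (real \<Rightarrow> real) \<Rightarrow> real \<Rightarrow> real set" where
  "inv_comp g f x = {z \<in> unit_I. g z = f x}"

lemma is_tent_map_exists:
  assumes "n \<ge> 2"
  shows "\<exists>T. is_tent_map n T"
proof -
  define T where "T = (\<lambda>x::real. arccos (cos (real n * pi * x)) / pi)"
  have n: "real n > 0" using assms by simp
  have node: "T (real i / real n) = (if even i then 0 else 1)" for i
  proof -
    have "real n * pi * (real i / real n) = real i * pi" using n by simp
    thus ?thesis by (simp add: T_def cos_npi)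
  qed
  have lin: "\<exists>a b. \<forall>x\<in>{real i / real n..real (i + 1) / real n}. T x = a * x + b" for i
  proof -
    have bnd: "real i * pi \<le> real n * pi * x \<and> real n * pi * x \<le> real i * pi + pi"
      if "x \<in> {real i / real n..real (i + 1) / real n}" for x
    proof -
      have "real i \<le> real n * x" "real n * x \<le> real i + 1"
        using that n by (auto simp: field_simps)
      hence "real i * pi \<le> (real n * x) * pi" "(real n * x) * pi \<le> (real i + 1) * pi"
        by (auto intro!: mult_right_mono)
      thus ?thesis by (simp add: algebra_simps)
    qed
    show ?thesis
    proof (cases "even i")
      case True
      have "T x = real n * x + (- real i)" if "x \<in> {real i / real n..real (i + 1) / real n}" for x
      proof -
        have "cos (real n * pi * x - real i * pi) = cos (real n * pi * x)"
          using True by (simp add: cos_diff cos_npi sin_npi)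
        moreover have "arccos (cos (real n * pi * x - real i * pi)) = real n * pi * x - real i * pi"
          using bnd[OF that] by (intro arccos_cos) auto
        ultimately show ?thesis by (simp add: T_def field_simps)
      qed
      thus ?thesis by blast
    next
      case False
      have "T x = (- real n) * x + (real i + 1)"
        if "x \<in> {real i / real n..real (i + 1) / real n}" for x
      proof -
        have "cos (real (Suc i) * pi - real n * pi * x) = cos (real n * pi * x)"
          using False by (simp only: cos_diff cos_npi sin_npi) simp
        moreover have "arccos (cos (real (Suc i) * pi - real n * pi * x))
            = real (Suc i) * pi - real n * pi * x"
          using bnd[OF that] by (intro arccos_cos) (auto simp: algebra_simps)
        ultimately show ?thesis by (simp add: T_def field_simps)
      qed
      thus ?thesis by blast
    qed
  qed
  have "T \<in> unit_I \<rightarrow> unit_I"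
    by (auto simp: T_def arccos_lbound arccos_ubound field_simps)
  moreover have "continuous_on unit_I T"
    unfolding T_def by (intro continuous_intros) auto
  ultimately have "is_tent_map n T"
    unfolding is_tent_map_def using node lin by auto
  thus ?thesis by blast
qed

lemma is_tent_map_unique:
  assumes "n \<ge> 2" "is_tent_map n S" "is_tent_map n T" "x \<in> unit_I"
  shows "S x = T x"
proof -
  have n: "real n > 0" using assms(1) by simp
  obtain i where i: "i < n" "x \<in> {real i / real n..real (i + 1) / real n}"
  proof (cases "x = 1")
    case True
    show ?thesis by (rule that[of "n - 1"]) (use True n in \<open>auto simp: field_simps\<close>)
  next
    case False
    define k where "k = nat \<lfloor>real n * x\<rfloor>"
    have "0 \<le> real n * x" using assms(4) by simp
    hence k: "real k \<le> real n * x" "real n * x < real k + 1" unfolding k_def by linarith+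
    have "real n * x < real n" using False assms(4) n by simp
    hence "k < n" using k by linarith
    thus ?thesis using k n by (intro that[of k]) (auto simp: field_simps)
  qed
  let ?l = "real i / real n" and ?r = "real (i + 1) / real n"
  obtain a b where S: "\<And>y. y \<in> {?l..?r} \<Longrightarrow> S y = a * y + b"
    using assms(2) i(1) unfolding is_tent_map_def by (metis atLeastLessThan_iff le0)
  obtain c d where T: "\<And>y. y \<in> {?l..?r} \<Longrightarrow> T y = c * y + d"
    using assms(3) i(1) unfolding is_tent_map_def by (metis atLeastLessThan_iff le0)
  have lr: "?l < ?r" using n by (simp add: divide_strict_right_mono)
  have agree: "S (real j / real n) = T (real j / real n)" if "j \<le> n" for j
    using assms(2,3) that unfolding is_tent_map_def by (cases "even j") auto
  have l: "a * ?l + b = c * ?l + d"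
    using agree[of i] S[of ?l] T[of ?l] lr i(1) by simp
  have r: "a * ?r + b = c * ?r + d"
    using agree[of "i + 1"] S[of ?r] T[of ?r] lr i(1) by simp
  have "(a - c) * (?r - ?l) = 0" using l r by (simp only: algebra_simps)
  hence "a = c" using lr by (simp only: mult_eq_0_iff) linarith
  moreover from this have "b = d" using l by simp
  ultimately show ?thesis using S[OF i(2)] T[OF i(2)] by simp
qed

end

(* The tent map is characterised on I by cos (pi T_n x) = cos (n pi x), and cos a = cos b
   implies cos (k a) = cos (k b) for natural k; hence T_n and T_m commute, which is the inclusion
   from left to right.  Conversely, T_m z = T_n x says m z = n x' + 2 k with x' = x or x' = -x and
   k an integer.  As n is invertible modulo m, there is an integer a with n a congruent to k
   modulo m, and y = (x' + 2 a) / m satisfies m y = x' and n y = z modulo 2.  Folding y into I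
   gives the required point. *)
theory Submission imports Defs begin

text \<open>Equal cosines mean a = b or a = -b modulo 2 pi, and multiplication by an integer
  preserves either congruence.\<close>

lemma cos_mult_cong:
  fixes a b :: real
  assumes "cos a = cos b"
  shows "cos (real k * a) = cos (real k * b)"
proof -
  obtain j where j: "j \<in> \<int>" and ab: "a = b + 2 * j * pi \<or> a = - b + 2 * j * pi"
    using assms by (auto simp: cos_eq)
  have "real k * j \<in> \<int>" using j by simp
  moreover from ab have "real k * a = real k * b + 2 * (real k * j) * pi
      \<or> real k * a = - (real k * b) + 2 * (real k * j) * pi"
    by (elim disjE; hypsubst; simp add: algebra_simps)
  ultimately show ?thesis unfolding cos_eq by blast
qed

text \<open>The witness folds the line onto I by the symmetries of the cosine, the reflection in 0
  and the translations by 2 pi.\<close>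

lemma obtain_unit_interval_cos_eq:
  fixes t :: real
  obtains y where "y \<in> unit_I" "cos (pi * y) = cos t"
proof
  show "arccos (cos t) / pi \<in> unit_I"
    by (auto simp: arccos_lbound arccos_ubound)
  show "cos (pi * (arccos (cos t) / pi)) = cos t" by simp
qed

lemma cos_pi_inj_unit:
  fixes x y :: real
  assumes "x \<in> unit_I" "y \<in> unit_I" "cos (pi * x) = cos (pi * y)"
  shows "x = y"
proof -
  have "pi * x = pi * y"
    by (rule cos_inj_pi) (use assms mult_left_le[of _ pi] in auto)
  thus ?thesis by simp
qed

lemma obtain_grid_interval:
  fixes x :: real
  assumes "n > 0" "x \<in> unit_I"
  obtains i where "i < n" "x \<in> {real i / real n..real (i + 1) / real n}"
proof (cases "x = 1")
  \<comment> \<open>At x = 1 the floor used below would be n, one past the last interval.\<close>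
  case True
  show ?thesis by (rule that[of "n - 1"]) (use True assms in \<open>auto simp: field_simps\<close>)
next
  case False
  define k where "k = nat \<lfloor>real n * x\<rfloor>"
  have "0 \<le> real n * x" using assms by simp
  hence k: "real k \<le> real n * x" "real n * x < real k + 1" unfolding k_def by linarith+
  have "real n * x < real n" using False assms by simp
  hence "k < n" using k by linarith
  thus ?thesis using k assms by (intro that[of k]) (auto simp: field_simps)
qed

text \<open>On the i-th interval T x is n x - i for even i and (i + 1) - n x for odd i. The integer
  constant is even in both cases, so cosine does not see it, nor the sign.\<close>

lemma cos_tent_map:
  assumes "n > 0" "is_tent_map n T" "x \<in> unit_I"
  shows "cos (pi * T x) = cos (real n * (pi * x))"
proof -
  obtain i where i: "i < n" "x \<in> {real i / real n..real (i + 1) / real n}"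
    using obtain_grid_interval assms(1,3) by blast
  obtain a b where ab: "\<And>y. y \<in> {real i / real n..real (i + 1) / real n} \<Longrightarrow> T y = a * y + b"
    using assms(2) i(1) unfolding is_tent_map_def by (metis atLeastLessThan_iff le0)
  have node: "T (real j / real n) = (if even j then 0 else 1)" if "j \<le> n" for j
    using assms(2) that unfolding is_tent_map_def by auto
  have "real i / real n \<le> real (i + 1) / real n" by (simp add: divide_right_mono)
  hence l: "a * (real i / real n) + b = (if even i then 0 else 1)"
    and r: "a * (real (i + 1) / real n) + b = (if even i then 1 else 0)"
    using ab[of "real i / real n"] ab[of "real (i + 1) / real n"] node[of i] node[of "i + 1"] i(1)
    by auto
  \<comment> \<open>The values at the two ends differ by 1 over a length 1/n; the parity of i gives
    the sign.\<close>
  have a: "a = (if even i then real n else - real n)"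
  proof -
    have "a * (real (i + 1) / real n) - a * (real i / real n) = a / real n"
      using assms(1) by (simp add: field_simps)
    hence "a / real n = (if even i then 1 else - 1)" using l r by (cases "even i"; simp only: if_True if_False; linarith)
    thus ?thesis using assms(1) by (auto simp: field_simps split: if_splits)
  qed
  show ?thesis
  proof (cases "even i")
    case True
    hence Tx: "T x = real n * x - real i" using ab[OF i(2)] a l assms(1) by simp
    have "pi * T x = real n * (pi * x) - real i * pi" unfolding Tx by (simp add: algebra_simps)
    thus ?thesis using True by (simp add: cos_diff cos_npi sin_npi)
  next
    case False
    hence Tx: "T x = real (i + 1) - real n * x" using ab[OF i(2)] a l assms(1) by simp
    have "pi * T x = real (i + 1) * pi - real n * (pi * x)"
      unfolding Tx by (simp add: algebra_simps)
    thus ?thesis using False by (simp only: cos_diff cos_npi sin_npi) simp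
  qed
qed

text \<open>Since cos (pi y) is injective for y in I, the cosine equation loses no information; both
  inclusions are then argued with cosines alone.\<close>

lemma tent_map_eq_iff:
  assumes "n > 0" "is_tent_map n T" "x \<in> unit_I" "y \<in> unit_I"
  shows "T x = y \<longleftrightarrow> cos (real n * (pi * x)) = cos (pi * y)"
proof -
  have "T x \<in> unit_I" using assms(2,3) unfolding is_tent_map_def by blast
  thus ?thesis using cos_tent_map[OF assms(1-3)] cos_pi_inj_unit assms(4) by metis
qed

lemma coprime_cos_multiples:
  fixes x z :: real
  assumes "m > 0" "coprime n m"
    and "cos (real m * (pi * z)) = cos (real n * (pi * x))"
  obtains t where "cos (real m * t) = cos (pi * x)" "cos (real n * t) = cos (pi * z)"
proof -
  obtain j where j: "j \<in> \<int>" "real m * (pi * z) = real n * (pi * x) + 2 * j * pi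
      \<or> real m * (pi * z) = - (real n * (pi * x)) + 2 * j * pi"
    using assms(3) unfolding cos_eq by blast
  obtain k :: int where k: "j = of_int k" using j(1) by (auto elim: Ints_cases)
  \<comment> \<open>The sign goes into x', so that one computation serves both cases; evenness of
    cosine removes it at the end.\<close>
  obtain x' where x': "x' = x \<or> x' = - x" and
    "pi * (real m * z) = pi * (real n * x' + 2 * of_int k)"
    using j(2) unfolding k
    by (elim disjE) (rule that[of x] that[of "- x"]; simp add: algebra_simps)+
  hence mz: "real m * z = real n * x' + 2 * of_int k" by simp
  \<comment> \<open>Here u inverts n modulo m, so u * k is the integer a of the overview, and c
    below is the quotient (n a - k) / m.\<close>
  obtain u v where uv: "u * int n + v * int m = 1"
    using bezout_int[of "int n" "int m"] assms(2) by auto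
  define c where "c = - (v * k)"
  have c: "int n * (u * k) = k + int m * c"
    using arg_cong[OF uv, of "\<lambda>w. w * k"] by (simp add: c_def algebra_simps)
  have c': "real n * of_int (u * k) = of_int k + real m * of_int c"
    using arg_cong[OF c, of real_of_int] by simp
  define y where "y = (x' + 2 * of_int (u * k)) / real m"
  have my: "real m * y = x' + 2 * of_int (u * k)" using assms(1) by (simp add: y_def)
  \<comment> \<open>Multiplying by m clears the denominator of y; m is cancelled afterwards.\<close>
  have "real m * (real n * y) = real n * (real m * y)" by simp
  also have "\<dots> = real n * x' + 2 * (real n * of_int (u * k))"
    unfolding my by (simp add: algebra_simps)
  also have "\<dots> = real m * (z + 2 * of_int c)"
    unfolding c' using mz by (simp add: algebra_simps)
  finally have ny: "real n * y = z + 2 * of_int c" using assms(1) by simp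
  show ?thesis
  proof (rule that[of "pi * y"])
    have "real m * (pi * y) = pi * x' + 2 * of_int (u * k) * pi"
      using arg_cong[OF my, of "(*) pi"] by (simp add: algebra_simps)
    hence "cos (real m * (pi * y)) = cos (pi * x')" unfolding cos_eq using Ints_of_int by blast
    thus "cos (real m * (pi * y)) = cos (pi * x)" using x' by auto
    have "real n * (pi * y) = pi * z + 2 * of_int c * pi"
      using arg_cong[OF ny, of "(*) pi"] by (simp add: algebra_simps)
    thus "cos (real n * (pi * y)) = cos (pi * z)" unfolding cos_eq using Ints_of_int by blast
  qed
qed

theorem proposition3p3:
  fixes n m :: nat and T\<^sub>n T\<^sub>m :: "real \<Rightarrow> real"
  assumes "n \<ge> 2" and "m \<ge> 2" and "coprime n m"
    and "is_tent_map n T\<^sub>n" and "is_tent_map m T\<^sub>m"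
  shows "\<forall>x\<in>unit_I. comp_inv T\<^sub>n T\<^sub>m x = inv_comp T\<^sub>m T\<^sub>n x"
proof
  fix x assume x: "x \<in> unit_I"
  have n: "n > 0" and m: "m > 0" using assms(1,2) by auto
  note eqn = tent_map_eq_iff[OF n assms(4)] and eqm = tent_map_eq_iff[OF m assms(5)]
  have In: "T\<^sub>n y \<in> unit_I" if "y \<in> unit_I" for y
    using assms(4) that unfolding is_tent_map_def by blast
  have inv: "T\<^sub>m z = T\<^sub>n x \<longleftrightarrow> cos (real m * (pi * z)) = cos (real n * (pi * x))"
    if "z \<in> unit_I" for z
    using eqm[OF that In[OF x]] cos_tent_map[OF n assms(4) x] by simp
  show "comp_inv T\<^sub>n T\<^sub>m x = inv_comp T\<^sub>m T\<^sub>n x"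
  proof (intro equalityI subsetI)
    fix z assume "z \<in> comp_inv T\<^sub>n T\<^sub>m x"
    then obtain y where y: "y \<in> unit_I" "T\<^sub>m y = x" "T\<^sub>n y = z"
      unfolding comp_inv_def by blast
    have z: "z \<in> unit_I" using In y by blast
    \<comment> \<open>Both sides are the cosine of m n pi y, reached by applying the two
      multiplications in either order.\<close>
    have "cos (real m * (pi * z)) = cos (real m * (real n * (pi * y)))"
      using eqn[OF y(1) z] y(3) by (intro cos_mult_cong) simp
    also have "\<dots> = cos (real n * (real m * (pi * y)))" by (simp add: mult.left_commute)
    also have "\<dots> = cos (real n * (pi * x))"
      using eqm[OF y(1) x] y(2) by (intro cos_mult_cong) simp
    finally show "z \<in> inv_comp T\<^sub>m T\<^sub>n x" using inv[OF z] z unfolding inv_comp_def by blast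
  next
    fix z assume "z \<in> inv_comp T\<^sub>m T\<^sub>n x"
    hence z: "z \<in> unit_I" and "T\<^sub>m z = T\<^sub>n x" unfolding inv_comp_def by auto
    hence "cos (real m * (pi * z)) = cos (real n * (pi * x))" using inv by blast
    then obtain t where t: "cos (real m * t) = cos (pi * x)" "cos (real n * t) = cos (pi * z)"
      using coprime_cos_multiples[OF m assms(3)] by blast
    \<comment> \<open>Replacing t by pi y keeps the cosines of its multiples by m and by n, so y
      inherits both equations.\<close>
    obtain y where y: "y \<in> unit_I" "cos (pi * y) = cos t"
      by (rule obtain_unit_interval_cos_eq)
    have "T\<^sub>m y = x" using eqm[OF y(1) x] cos_mult_cong[OF y(2)] t(1) by metis
    moreover have "T\<^sub>n y = z" using eqn[OF y(1) z] cos_mult_cong[OF y(2)] t(2) by metis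
    ultimately show "z \<in> comp_inv T\<^sub>n T\<^sub>m x" using y(1) unfolding comp_inv_def by blast
  qed
qed

end
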